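(* Let $f\colon\mathbb{C}\to\mathbb{C}$ be a continuous SD map. Then $f(z)=z$ for all $z\in\mathbb{C}$, or $f(z)=\overline{z}$ for all $z\in\mathbb{C}$.
   Context: An SD map on a field $\mathbb{F}$ is a function $f\colon \mathbb{F}\to\mathbb{F}$ such that for all $x \neq y$ in $\mathbb{F}$ one has $f(x)\neq f(y)$ and $f\left(\frac{x+y}{x-y}\right) = \frac{f(x)+f(y)}{f(x)-f(y)}$. *)

theory Defs
  imports Complex_Main
begin

definition SD_map :: "('a::field \<Rightarrow> 'a) \<Rightarrow> bool" where
  "SD_map f \<longleftrightarrow>
    (\<forall>x y. x \<noteq> y \<longrightarrow> f x \<noteq> f y \<and> f ((x + y) / (x - y)) = (f x + f y) / (f x - f y))"

end

theory Submission
  imports Defs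
begin

text \<open>
  Comparing the equation at \<open>(x, y)\<close> with the one at \<open>(x / y, 1)\<close> shows that an SD map is
  multiplicative. Evaluating at \<open>2\<close>, \<open>3\<close>, \<open>4\<close>, \<open>5\<close> forces \<open>f 2 = 2\<close>, so \<open>f\<close> fixes the
  rationals and, by continuity, the reals. Since \<open>f \<i> = \<plusminus> \<i>\<close>, the equation at \<open>(a, \<i> b)\<close> with
  \<open>a\<close>, \<open>b\<close> real determines \<open>f\<close> at \<open>s / cnj s\<close> for \<open>s = a + \<i> b\<close>, hence at
  \<open>s\<^sup>2 = \<bar>s\<bar>\<^sup>2 (s / cnj s)\<close>, and every complex number is a square.
\<close>

lemma SD_map_inj: "SD_map f \<Longrightarrow> f x = f y \<longleftrightarrow> x = y"
  unfolding SD_map_def by auto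

lemma SD_map_eq:
  "SD_map f \<Longrightarrow> x \<noteq> y \<Longrightarrow> f ((x + y) / (x - y)) = (f x + f y) / (f x - f y)"
  unfolding SD_map_def by auto

context
  fixes f :: "'a::field_char_0 \<Rightarrow> 'a"
  assumes SD: "SD_map f"
begin

text \<open>The pair \<open>(x, 0)\<close> has quotient 1. After clearing denominators the right
  side of \<open>*\<close> is independent of \<open>x\<close>, so taking 1 and 2 for
  \<open>x\<close> and using injectivity forces \<open>f 1 = 1\<close>.\<close>

lemma SD_map_0_1: "f 0 = 0 \<and> f 1 = 1"
proof -
  have *: "f x * (f 1 - 1) = f 0 * (f 1 + 1)" if "x \<noteq> 0" for x
  proof -
    have "f 1 = (f x + f 0) / (f x - f 0)"
      using SD_map_eq[OF SD that] that by simp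
    moreover have "f x - f 0 \<noteq> 0"
      using SD_map_inj[OF SD] that by simp
    ultimately show ?thesis
      by (simp add: field_simps)
  qed
  have "f 1 * (f 1 - 1) = f 2 * (f 1 - 1)"
    using *[of 1] *[of 2] by simp
  moreover have "f 1 \<noteq> f 2"
    using SD_map_inj[OF SD] by simp
  ultimately have "f 1 = 1" by simp
  with *[of 1] show ?thesis by simp
qed

lemma SD_map_0: "f 0 = 0" and SD_map_1: "f 1 = 1"
  using SD_map_0_1 by auto

lemma SD_map_eq_0_iff: "f x = 0 \<longleftrightarrow> x = 0"
  using SD_map_inj[OF SD, of x 0] SD_map_0 by simp

lemma SD_map_minus: "f (- x) = - f x"
proof (cases "x = 0")
  case False
  then have ne: "x \<noteq> - x" by (simp add: eq_neg_iff_add_eq_0 flip: mult_2)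
  then have "(f x + f (- x)) / (f x - f (- x)) = 0"
    using SD_map_eq[OF SD ne] by (simp add: SD_map_0)
  then show ?thesis
    using SD_map_inj[OF SD] ne by (simp add: add_eq_0_iff)
qed (simp add: SD_map_0)

lemma SD_map_divide: "f (x / y) = f x / f y"
proof (cases "y = 0 \<or> x = y")
  case True
  then show ?thesis
    by (auto simp: SD_map_0 SD_map_1 SD_map_eq_0_iff)
next
  case False
  let ?t = "x / y"
  have y: "y \<noteq> 0" and xy: "x \<noteq> y" and t: "?t \<noteq> 1" using False by auto
  have fy: "f y \<noteq> 0" and fxy: "f x - f y \<noteq> 0" and ft: "f ?t - 1 \<noteq> 0"
    using y xy t SD_map_eq_0_iff SD_map_inj[OF SD] SD_map_inj[OF SD, of ?t 1] SD_map_1 by auto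
  have "(?t + 1) / (?t - 1) = (x + y) / (x - y)"
    using y xy by (simp add: field_simps)
  then have "(f ?t + 1) / (f ?t - 1) = (f x + f y) / (f x - f y)"
    using SD_map_eq[OF SD t] SD_map_eq[OF SD xy] SD_map_1 by simp
  then have "(f ?t + 1) * (f x - f y) = (f x + f y) * (f ?t - 1)"
    using fxy ft by (simp add: frac_eq_eq)
  then have "2 * (f ?t * f y) = 2 * f x" by algebra
  then show ?thesis using fy by (simp add: field_simps)
qed

lemma SD_map_mult: "f (x * y) = f x * f y"
  using SD_map_divide[of x "1 / y"] SD_map_divide[of 1 y] by (simp add: SD_map_1)

text \<open>With \<open>?a\<close> for \<open>f 2\<close>, the value \<open>f 5\<close> is computed
  twice: from 5/3 = (4+1)/(4-1) with \<open>f 4 = ?a * ?a\<close>, and from 5 = (3+2)/(3-2). In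
  both, \<open>f 3\<close> comes from 3 = (2+1)/(2-1). Comparing leaves only the roots 0 and 2 for
  \<open>?a\<close>, and injectivity rules out 0.\<close>

lemma SD_map_2: "f 2 = 2"
proof -
  let ?a = "f 2"
  have a: "?a \<noteq> 0" "?a - 1 \<noteq> 0" "?a + 1 \<noteq> 0"
    using SD_map_eq_0_iff[of 2] SD_map_inj[OF SD, of 2 1] SD_map_inj[OF SD, of 2 "-1"]
    by (auto simp: SD_map_1 SD_map_minus add_eq_0_iff2)
  have f3: "f 3 = (?a + 1) / (?a - 1)"
    using SD_map_eq[OF SD, of 2 1] by (simp add: SD_map_1)
  have f4: "f 4 = ?a * ?a"
    using SD_map_mult[of 2 2] by simp
  have "?a * ?a - 1 = (?a + 1) * (?a - 1)" by algebra
  then have "f 5 / f 3 = (?a * ?a + 1) / ((?a + 1) * (?a - 1))"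
    using SD_map_eq[OF SD, of 4 1] by (simp add: SD_map_1 f4 flip: SD_map_divide)
  then have "f 5 * ((?a + 1) * (?a - 1)) = (?a * ?a + 1) * f 3"
    using a SD_map_eq_0_iff[of 3] by (subst (asm) frac_eq_eq) auto
  moreover have f3': "f 3 * (?a - 1) = ?a + 1"
    using a f3 by simp
  ultimately have "(?a + 1) * (f 5 * (?a - 1)\<^sup>2) = (?a + 1) * (?a\<^sup>2 + 1)"
    by algebra
  then have f5: "f 5 * (?a - 1)\<^sup>2 = ?a\<^sup>2 + 1"
    using a by simp
  have "f 3 - ?a \<noteq> 0"
    using SD_map_inj[OF SD, of 3 2] by simp
  then have "f 5 * (f 3 - ?a) = f 3 + ?a"
    using SD_map_eq[OF SD, of 3 2] by (simp add: field_simps)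
  with f3' have "f 5 * (?a + 1 - ?a * (?a - 1)) = ?a\<^sup>2 + 1"
    by algebra
  then have "f 5 * (?a * (?a - 2)) = 0"
    using f5 by algebra
  then show ?thesis
    using a SD_map_eq_0_iff[of 5] by simp
qed

lemma SD_map_of_nat: "f (of_nat n) = of_nat n"
proof (induction n rule: less_induct)
  case (less n)
  consider "n = 0" | "n = 1" | "n = 2" | m where "n = Suc (Suc (Suc m))"
    by (metis One_nat_def Suc_1 not0_implies_Suc)
  then show ?case
  proof cases
    \<comment> \<open>The pair \<open>(n - 1, 1)\<close> has quotient \<open>n / (n - 2)\<close>, so
      \<open>f\<close> at \<open>n\<close> follows from its two predecessors. The case
      \<open>n = 2\<close> is a base case because there the denominator vanishes.\<close>
    case 4
    let ?k = "of_nat (Suc (Suc m)) :: 'a" and ?m = "of_nat (Suc m) :: 'a"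
    have ne: "?k \<noteq> 1" by (simp only: of_nat_eq_1_iff)
    have sum: "?k + 1 = of_nat n" "?k - 1 = ?m" "?m \<noteq> 0"
      using 4 by (simp_all del: of_nat_Suc add: of_nat_diff) (simp_all add: add_eq_0_iff)
    have IH: "f ?k = ?k" "f ?m = ?m" using less 4 by (simp_all del: of_nat_Suc)
    have "f (of_nat n / ?m) = of_nat n / ?m"
      using SD_map_eq[OF SD ne] unfolding IH SD_map_1 sum .
    then show ?thesis
      using sum(3) by (simp add: SD_map_divide IH del: of_nat_Suc)
  qed (simp_all add: SD_map_0 SD_map_1 SD_map_2)
qed

lemma SD_map_of_rat: "f (of_rat q) = of_rat q"
proof -
  have int: "f (of_int k) = of_int k" for k
    by (cases k rule: int_cases2) (simp_all add: SD_map_of_nat SD_map_minus)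
  obtain a b where "q = Fract a b" "b > 0" by (cases q)
  then show ?thesis
    by (simp add: of_rat_rat SD_map_divide int)
qed

end

lemma continuous_SD_map_of_real:
  fixes f :: "'a::real_normed_field \<Rightarrow> 'a"
  assumes cont: "continuous_on UNIV f" and SD: "SD_map f"
  shows "f (of_real r) = of_real r"
proof (rule ccontr)
  assume neq: "f (of_real r) \<noteq> of_real r"
  have "continuous_on UNIV (\<lambda>x. f (of_real x))"
    by (intro continuous_on_compose2[OF cont] continuous_intros) auto
  \<comment> \<open>An open set of disagreement would contain an interval to the right of
    \<open>r\<close>, hence a rational point, where \<open>f\<close> is already known.\<close>
  then have "open {x::real. f (of_real x) \<noteq> of_real x}"
    by (intro open_Collect_neq continuous_intros)
  then obtain b where b: "b > r" "{r..<b} \<subseteq> {x. f (of_real x) \<noteq> of_real x}"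
    using open_right[of _ r "r + 1"] neq by auto
  then obtain q where q: "r < of_rat q" "of_rat q < b"
    using of_rat_dense by blast
  have "(of_real (of_rat q) :: 'a) = of_rat q"
    by (cases q) (simp add: of_rat_rat)
  then show False
    using SD_map_of_rat[OF SD, of q] b(2) q
    by (auto simp: subset_eq dest: bspec[of _ _ "of_rat q"])
qed

theorem theorem4p3:
  fixes f :: "complex \<Rightarrow> complex"
  assumes "continuous_on UNIV f" and "SD_map f"
  shows "(\<forall>z. f z = z) \<or> (\<forall>z. f z = cnj z)"
proof -
  note SD = assms(2)
  note real = continuous_SD_map_of_real[OF assms]
  have "f \<i> * f \<i> = \<i> * \<i>"
    using SD_map_mult[OF SD, of \<i> \<i>] SD_map_minus[OF SD, of 1] SD_map_1[OF SD] by simp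
  then have e: "f \<i> = \<i> \<or> f \<i> = - \<i>"
    by (simp only: square_eq_iff)
  have sq: "f (s * s) = (if f \<i> = \<i> then s * s else cnj (s * s))" for s
  proof (cases "s = 0")
    case False
    let ?x = "of_real (Re s) :: complex" and ?y = "\<i> * of_real (Im s)"
    have s: "?x + ?y = s" "?x - ?y = cnj s"
      by (simp_all add: complex_eq_iff)
    \<comment> \<open>The difference is \<open>cnj s\<close>, which is nonzero.\<close>
    have "?x \<noteq> ?y" using s(2) False by auto
    then have "f (s / cnj s) = (?x + f \<i> * of_real (Im s)) / (?x - f \<i> * of_real (Im s))"
      using SD_map_eq[OF SD, of ?x ?y] unfolding s by (simp add: SD_map_mult[OF SD] real)
    \<comment> \<open>If \<open>f \<i> = - \<i>\<close>, numerator and denominator trade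
      places.\<close>
    then have quot: "f (s / cnj s) = (if f \<i> = \<i> then s / cnj s else cnj s / s)"
      using e s by auto
    have "s * s = of_real ((cmod s)\<^sup>2) * (s / cnj s)"
      using False by (simp add: complex_norm_square del: of_real_power)
    then have "f (s * s) = of_real ((cmod s)\<^sup>2) * f (s / cnj s)"
      by (metis SD_map_mult[OF SD] real)
    then show ?thesis
      using False unfolding quot by (simp add: complex_norm_square del: of_real_power)
  qed (simp add: SD_map_0[OF SD])
  \<comment> \<open>The condition does not depend on \<open>z\<close>, so the same alternative holds
    for every \<open>z\<close>.\<close>
  have "f z = (if f \<i> = \<i> then z else cnj z)" for z
    using sq[of "csqrt z"] by (simp flip: power2_eq_square)
  then show ?thesis by metis
qed

end
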